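(* For an arbitrary subset $A\subset\mathbb{R}$, the space $(\mathbb{R},\tau_A)$ is zero-dimensional if and only if $\mathbb{R}\setminus A$ is dense in $(\mathbb{R},\tau_E)$.
   Context: For $A\subset\mathbb{R}$, $\tau_A$ is the topology on $\mathbb{R}$ in which each $x\in A$ has neighborhood base $\{(x-\varepsilon,x+\varepsilon):\varepsilon>0\}$ and each $x\in\mathbb{R}\setminus A$ has neighborhood base $\{[x,x+\varepsilon):\varepsilon>0\}$. $\tau_E$ is the usual (Euclidean) topology on $\mathbb{R}$. A space is zero-dimensional if it has a base consisting of sets that are both open and closed. *)

theory Defs
  imports "HOL-Analysis.Analysis"
begin

definition tau_basic :: "real set \<Rightarrow> real \<Rightarrow> real \<Rightarrow> real set" where
  "tau_basic A x e = (if x \<in> A then {x - e<..<x + e} else {x..<x + e})"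

text \<open>
  The local bases \<open>{tau_basic A x e | e > 0}\<close> determine the topology: a set is open iff it
  contains a basic set around each of its points.
\<close>

definition tau :: "real set \<Rightarrow> real topology" where
  "tau A = topology (\<lambda>U. \<forall>x\<in>U. \<exists>e>0. tau_basic A x e \<subseteq> U)"

lemma istopology_tau: "istopology (\<lambda>U. \<forall>x\<in>U. \<exists>e>0. tau_basic A x e \<subseteq> U)"
  unfolding istopology_def
proof (intro conjI allI impI ballI)
  fix S T x
  assume S: "\<forall>x\<in>S. \<exists>e>0. tau_basic A x e \<subseteq> S" and T: "\<forall>x\<in>T. \<exists>e>0. tau_basic A x e \<subseteq> T"
    and x: "x \<in> S \<inter> T"
  obtain d where d: "d > 0" "tau_basic A x d \<subseteq> S" using S x by blast
  obtain e where e: "e > 0" "tau_basic A x e \<subseteq> T" using T x by blast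
  have "tau_basic A x (min d e) \<subseteq> tau_basic A x d \<inter> tau_basic A x e"
    by (auto simp: tau_basic_def)
  then show "\<exists>e>0. tau_basic A x e \<subseteq> S \<inter> T"
    using d e by (intro exI[of _ "min d e"]) auto
next
  fix \<K> x
  assume K: "\<forall>K\<in>\<K>. \<forall>x\<in>K. \<exists>e>0. tau_basic A x e \<subseteq> K" and "x \<in> \<Union>\<K>"
  then obtain K where "K \<in> \<K>" "x \<in> K" by blast
  moreover from this K obtain e where "e > 0" "tau_basic A x e \<subseteq> K" by blast
  ultimately show "\<exists>e>0. tau_basic A x e \<subseteq> \<Union>\<K>" by (meson Union_upper order_trans)
qed

lemma openin_tau: "openin (tau A) U \<longleftrightarrow> (\<forall>x\<in>U. \<exists>e>0. tau_basic A x e \<subseteq> U)"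
  by (simp add: tau_def istopology_tau topology_inverse')

lemma topspace_tau [simp]: "topspace (tau A) = UNIV"
proof -
  have "openin (tau A) UNIV"
    by (simp add: openin_tau gt_ex)
  then show ?thesis
    using openin_subset by blast
qed

lemma mem_tau_basic: "e > 0 \<Longrightarrow> x \<in> tau_basic A x e"
  by (simp add: tau_basic_def)

lemma openin_tau_basic: "openin (tau A) (tau_basic A x e)"
  unfolding openin_tau
proof
  fix y assume y: "y \<in> tau_basic A x e"
  show "\<exists>d>0. tau_basic A y d \<subseteq> tau_basic A x e"
  proof (cases "x \<notin> A \<and> y = x")
    case True
    then show ?thesis using y by (intro exI[of _ e]) (simp add: tau_basic_def)
  next
    case False
    define l where "l = (if x \<in> A then x - e else x)"
    have ly: "l < y" "y < x + e" and lx: "{l<..<x + e} \<subseteq> tau_basic A x e"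
      using y False by (auto simp: tau_basic_def l_def split: if_splits)
    define d where "d = min (y - l) (x + e - y)"
    have d: "d > 0" "d \<le> y - l" "d \<le> x + e - y"
      using ly by (simp_all add: d_def)
    then have "tau_basic A y d \<subseteq> {l<..<x + e}"
      using ly by (simp add: tau_basic_def subset_iff)
    with lx d(1) show ?thesis by (meson order_trans)
  qed
qed

lemma neighbourhood_base_at_tau:
  "neighbourhood_base_at x (\<lambda>V. \<exists>e>0. V = tau_basic A x e) (tau A)"
  unfolding neighbourhood_base_at_def
proof (intro allI impI)
  fix W assume "openin (tau A) W \<and> x \<in> W"
  then obtain e where "e > 0" "tau_basic A x e \<subseteq> W" by (auto simp: openin_tau)
  then show "\<exists>U V. openin (tau A) U \<and> (\<exists>e>0. V = tau_basic A x e) \<and> x \<in> U \<and> U \<subseteq> V \<and> V \<subseteq> W"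
    using openin_tau_basic[of A x e] mem_tau_basic[of e x A]
    by (intro exI[of _ "tau_basic A x e"]) auto
qed

text \<open>No separation axiom is included.\<close>

definition zero_dimensional_space :: "'a topology \<Rightarrow> bool" where
  "zero_dimensional_space X \<longleftrightarrow>
     (\<exists>\<B>. openin X = arbitrary union_of (\<lambda>V. V \<in> \<B>) \<and>
          (\<forall>V\<in>\<B>. openin X V \<and> closedin X V))"

end

theory Submission
  imports Defs
begin

text \<open>
  The half-open intervals with end points outside \<open>A\<close> are clopen, and they form a base as soon as
  such end points are dense. Conversely, on an interval contained in \<open>A\<close> the topology is Euclidean,
  so a small clopen set inside it would be a bounded nonempty Euclidean clopen subset of the
  connected real line.
\<close>

text \<open>Pointwise form in which both directions of the theorem are argued. For the converse, the
  family of all clopen sets serves as the base.\<close>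

lemma zero_dimensional_space_iff:
  "zero_dimensional_space X \<longleftrightarrow>
     (\<forall>U x. openin X U \<and> x \<in> U \<longrightarrow> (\<exists>V. openin X V \<and> closedin X V \<and> x \<in> V \<and> V \<subseteq> U))"
  (is "?lhs \<longleftrightarrow> ?rhs")
proof
  assume ?lhs
  then show ?rhs
    unfolding zero_dimensional_space_def openin_topology_base_unique by meson
next
  assume ?rhs
  then show ?lhs
    unfolding zero_dimensional_space_def openin_topology_base_unique
    by (intro exI[of _ "{V. openin X V \<and> closedin X V}"]) auto
qed

lemma openin_tau_if_open:
  assumes "open U"
  shows "openin (tau A) U"
  unfolding openin_tau
proof
  fix x assume "x \<in> U"
  then obtain e where e: "e > 0" "ball x e \<subseteq> U"
    using assms open_contains_ball by blast
  have "tau_basic A x e \<subseteq> ball x e"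
    using e(1) by (auto simp: tau_basic_def dist_real_def)
  with e show "\<exists>e>0. tau_basic A x e \<subseteq> U" by blast
qed

text \<open>At points of \<open>A\<close> the basic sets are Euclidean balls, so there
  \<open>tau A\<close> is no finer than the usual topology.\<close>

lemma ball_subset_if_openin_tau:
  assumes "openin (tau A) U" "x \<in> U" "x \<in> A"
  shows "\<exists>e>0. ball x e \<subseteq> U"
  using assms(1)[unfolded openin_tau, rule_format, OF assms(2)] assms(3)
  by (simp add: tau_basic_def ball_eq_greaterThanLessThan)

text \<open>Since \<open>p\<close> is outside \<open>A\<close>, it needs room only to its right; any
  \<open>y > p\<close> has room \<open>y - p\<close> to its left.\<close>

lemma openin_tau_atLeast:
  assumes "p \<notin> A"
  shows "openin (tau A) {p..}"
  unfolding openin_tau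
proof
  fix y assume "y \<in> {p..}"
  then show "\<exists>e>0. tau_basic A y e \<subseteq> {p..}"
    using assms by (cases "y = p")
      (auto simp: tau_basic_def intro: exI[of _ 1] exI[of _ "y - p"])
qed

lemma closedin_tau_atLeast: "closedin (tau A) {p..}"
  by (simp add: closedin_def Compl_eq_Diff_UNIV[symmetric] openin_tau_if_open)

lemma clopen_tau_atLeastLessThan:
  assumes "p \<notin> A" "q \<notin> A"
  shows "openin (tau A) {p..<q}" "closedin (tau A) {p..<q}"
proof -
  have *: "{p..<q} = {p..} - {q..}" by auto
  show "openin (tau A) {p..<q}" "closedin (tau A) {p..<q}"
    unfolding * using assms
    by (simp_all add: openin_diff closedin_diff openin_tau_atLeast closedin_tau_atLeast)
qed

lemma zero_dimensional_space_tau_if_dense: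
  assumes dense: "closure (- A) = UNIV"
  shows "zero_dimensional_space (tau A)"
  unfolding zero_dimensional_space_iff
proof (intro allI impI, elim conjE)
  have between: "\<exists>r. r \<notin> A \<and> a < r \<and> r < b" if "a < b" for a b
    using open_Int_closure_eq_empty[of "{a<..<b}" "- A"] dense that by auto
  fix U x assume "openin (tau A) U" "x \<in> U"
  then obtain e where e: "e > 0" "tau_basic A x e \<subseteq> U"
    by (auto simp: openin_tau)
  obtain q where q: "q \<notin> A" "x < q" "q < x + e"
    using between[of x "x + e"] e by auto
  \<comment> \<open>A two-sided basic set leaves room for \<open>p\<close> to the left of
    \<open>x\<close>; a one-sided one forces \<open>p = x\<close>, which is allowed because then
    \<open>x\<close> is outside \<open>A\<close>.\<close>
  obtain p where p: "p \<notin> A" "p \<le> x" "{p..<q} \<subseteq> tau_basic A x e"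
  proof (cases "x \<in> A")
    case True
    obtain p where "p \<notin> A" "x - e < p" "p < x"
      using between[of "x - e" x] e by auto
    with True q show ?thesis by (intro that[of p]) (auto simp: tau_basic_def)
  next
    case False
    with q that[of x] show ?thesis by (auto simp: tau_basic_def)
  qed
  show "\<exists>V. openin (tau A) V \<and> closedin (tau A) V \<and> x \<in> V \<and> V \<subseteq> U"
    using clopen_tau_atLeastLessThan[OF p(1) q(1)] p q e by (intro exI[of _ "{p..<q}"]) auto
qed

lemma dense_if_zero_dimensional_space_tau:
  assumes "zero_dimensional_space (tau A)"
  shows "closure (- A) = UNIV"
proof (rule ccontr)
  assume "closure (- A) \<noteq> UNIV"
  then obtain x where "x \<in> interior A"
    by (auto simp: closure_complement)
  \<comment> \<open>A closed ball, so that its complement is open and points outside it have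
    Euclidean room.\<close>
  then obtain e where e: "e > 0" "cball x e \<subseteq> A"
    by (meson mem_interior_cball)
  have "openin (tau A) (ball x e)" "x \<in> ball x e"
    using e(1) by (simp_all add: openin_tau_if_open)
  then obtain V where V: "openin (tau A) V" "openin (tau A) (- V)" "x \<in> V" "V \<subseteq> ball x e"
    using assms unfolding zero_dimensional_space_iff closedin_def
    by (metis Compl_eq_Diff_UNIV topspace_tau)
  have "\<exists>d>0. ball y d \<subseteq> V" if "y \<in> V" for y
    using ball_subset_if_openin_tau[OF V(1) that] that V(4) e(2) ball_subset_cball by blast
  then have "open V"
    by (simp add: open_contains_ball)
  \<comment> \<open>Outside \<open>cball x e\<close>, where points may lie outside \<open>A\<close>, the complement of \<open>V\<close> is open because
      \<open>V\<close> stays away from there.\<close>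
  moreover have "\<exists>d>0. ball y d \<subseteq> - V" if "y \<in> - V" for y
  proof (cases "y \<in> cball x e")
    case True
    then show ?thesis using ball_subset_if_openin_tau[OF V(2) that] e(2) by blast
  next
    case False
    then obtain d where "d > 0" "ball y d \<subseteq> - cball x e"
      using open_contains_ball[of "- cball x e"] closed_cball[of x e] by (metis ComplI open_Compl)
    then show ?thesis using V(4) ball_subset_cball[of x e] by blast
  qed
  then have "closed V"
    by (simp add: closed_open open_contains_ball)
  ultimately have "V = UNIV"
    using V(3) clopen[of V] by blast
  \<comment> \<open>The end point \<open>x + e\<close> witnesses that the open ball is not the whole
    line.\<close>
  with V(4) have "x + e \<in> ball x e" by blast
  with e(1) show False by (simp add: dist_real_def)
qed

theorem theorem3p5:
  fixes A :: "real set"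
  shows "zero_dimensional_space (tau A) \<longleftrightarrow> closure (UNIV - A) = UNIV"
  using zero_dimensional_space_tau_if_dense dense_if_zero_dimensional_space_tau
  by (auto simp: Compl_eq_Diff_UNIV)

end
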